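(* Let $X,Y\in M(n,\mathbb{H})$. Then $\|[X,Y]\|^2\le 4\|X\|^2\|Y\|^2$. Equality holds if and only if either $\|X\|\|Y\|=0$, or $X=upu^*$ and $Y=uqu^*$ for some unit column vector $u\in\mathbb{H}^n$ and some purely imaginary quaternions $p,q\in\mathbb{H}$ whose coordinate vectors in the canonical basis are orthogonal (as real vectors).
   Context: $\mathbb{H}$ denotes the quaternions with canonical basis $1,\mathbf{i},\mathbf{j},\mathbf{k}$, and $M(n,\mathbb{H})$ the $n\times n$ quaternionic matrices; $[X,Y]=XY-YX$; $X^*$ is the (quaternionic) conjugate transpose, also for column vectors; for $X=(x_{ij})$, $\|X\|^2=\sum_{i,j}|x_{ij}|^2$ is the squared Frobenius norm (for a vector, the squared Euclidean norm). A purely imaginary quaternion is one with zero real part. *)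

theory Defs
  imports "HOL-Analysis.Analysis"
begin

section \<open>Quaternions\<close>

text \<open>\<open>Quat a b c d\<close> is the quaternion \<open>a + b i + c j + d k\<close>.\<close>

codatatype quat = Quat (qRe: real) (qI: real) (qJ: real) (qK: real)

lemma quat_eq_iff: "x = y \<longleftrightarrow> qRe x = qRe y \<and> qI x = qI y \<and> qJ x = qJ y \<and> qK x = qK y"
  by (auto intro: quat.expand)

instantiation quat :: ab_group_add
begin

primcorec zero_quat where
  "qRe 0 = 0" | "qI 0 = 0" | "qJ 0 = 0" | "qK 0 = 0"

primcorec plus_quat where
  "qRe (x + y) = qRe x + qRe y"
| "qI (x + y) = qI x + qI y"
| "qJ (x + y) = qJ x + qJ y"
| "qK (x + y) = qK x + qK y"

primcorec uminus_quat where
  "qRe (- x) = - qRe x"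
| "qI (- x) = - qI x"
| "qJ (- x) = - qJ x"
| "qK (- x) = - qK x"

primcorec minus_quat where
  "qRe (x - y) = qRe x - qRe y"
| "qI (x - y) = qI x - qI y"
| "qJ (x - y) = qJ x - qJ y"
| "qK (x - y) = qK x - qK y"

instance
  by standard (simp_all add: quat_eq_iff)

end

instantiation quat :: ring_1
begin

primcorec one_quat where
  "qRe 1 = 1" | "qI 1 = 0" | "qJ 1 = 0" | "qK 1 = 0"

primcorec times_quat where
  "qRe (x * y) = qRe x * qRe y - qI x * qI y - qJ x * qJ y - qK x * qK y"
| "qI (x * y) = qRe x * qI y + qI x * qRe y + qJ x * qK y - qK x * qJ y"
| "qJ (x * y) = qRe x * qJ y - qI x * qK y + qJ x * qRe y + qK x * qI y"
| "qK (x * y) = qRe x * qK y + qI x * qJ y - qJ x * qI y + qK x * qRe y"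

instance
  by standard (simp_all add: quat_eq_iff algebra_simps)

end

primcorec qcnj :: "quat \<Rightarrow> quat" where
  "qRe (qcnj x) = qRe x"
| "qI (qcnj x) = - qI x"
| "qJ (qcnj x) = - qJ x"
| "qK (qcnj x) = - qK x"

lemma qcnj_mult: "qcnj (x * y) = qcnj y * qcnj x"
  by (simp add: quat_eq_iff)

instantiation quat :: real_algebra_1
begin

primcorec scaleR_quat where
  "qRe (scaleR r x) = r * qRe x"
| "qI (scaleR r x) = r * qI x"
| "qJ (scaleR r x) = r * qJ x"
| "qK (scaleR r x) = r * qK x"

instance
  by standard (simp_all add: quat_eq_iff algebra_simps)

end

text \<open>The inner product is that of the coordinate vectors in \<open>\<real>\<^sup>4\<close>;
  the norm is the usual quaternionic modulus.\<close>

instantiation quat :: real_inner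
begin

definition inner_quat_def:
  "inner x y = qRe x * qRe y + qI x * qI y + qJ x * qJ y + qK x * qK y" for x y :: quat

definition norm_quat_def:
  "norm x = sqrt ((qRe x)\<^sup>2 + (qI x)\<^sup>2 + (qJ x)\<^sup>2 + (qK x)\<^sup>2)"

definition sgn_quat_def: "sgn x = x /\<^sub>R norm x" for x :: quat

definition dist_quat_def: "dist x y = norm (x - y)" for x y :: quat

definition uniformity_quat_def:
  "(uniformity :: (quat \<times> quat) filter) = (INF e\<in>{0 <..}. principal {(x, y). dist x y < e})"

definition open_quat_def:
  "open (U :: quat set) \<longleftrightarrow> (\<forall>x\<in>U. eventually (\<lambda>(x', y). x' = x \<longrightarrow> y \<in> U) uniformity)"

instance
proof
  fix x y z :: quat and r :: real
  show "inner x y = inner y x"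
    by (simp add: inner_quat_def algebra_simps)
  show "inner (x + y) z = inner x z + inner y z"
    by (simp add: inner_quat_def algebra_simps)
  show "inner (scaleR r x) y = r * inner x y"
    by (simp add: inner_quat_def algebra_simps)
  show "0 \<le> inner x x"
    by (simp add: inner_quat_def)
  show "inner x x = 0 \<longleftrightarrow> x = 0"
    by (simp add: inner_quat_def quat_eq_iff add_nonneg_eq_0_iff)
  show "norm x = sqrt (inner x x)"
    by (simp add: inner_quat_def norm_quat_def power2_eq_square)
qed (rule sgn_quat_def dist_quat_def open_quat_def uniformity_quat_def)+

end

lemma norm_quat_mult: "norm (x * y) = norm x * norm y" for x y :: quat
proof -
  have "(qRe (x * y))\<^sup>2 + (qI (x * y))\<^sup>2 + (qJ (x * y))\<^sup>2 + (qK (x * y))\<^sup>2 =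
    ((qRe x)\<^sup>2 + (qI x)\<^sup>2 + (qJ x)\<^sup>2 + (qK x)\<^sup>2) *
    ((qRe y)\<^sup>2 + (qI y)\<^sup>2 + (qJ y)\<^sup>2 + (qK y)\<^sup>2)"
    unfolding times_quat.sel by algebra
  then show ?thesis
    unfolding norm_quat_def by (simp only: real_sqrt_mult)
qed

instance quat :: real_normed_algebra_1
proof
  show "norm (x * y) \<le> norm x * norm y" for x y :: quat
    by (simp only: norm_quat_mult order_refl)
  show "norm (1::quat) = 1"
    by (simp add: norm_quat_def)
qed

definition purely_imaginary :: "quat \<Rightarrow> bool" where
  "purely_imaginary p \<longleftrightarrow> qRe p = 0"

text \<open>The defining relations of the canonical basis, as a check of the multiplication table.\<close>

lemma quat_units:
  defines "i \<equiv> Quat 0 1 0 0" and "j \<equiv> Quat 0 0 1 0" and "k \<equiv> Quat 0 0 0 1"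
  shows "i * i = - 1" "j * j = - 1" "k * k = - 1"
    "i * j = k" "j * k = i" "k * i = j" "j * i = - k" "k * j = - i" "i * k = - j"
    "Quat a b c d = a *\<^sub>R 1 + b *\<^sub>R i + c *\<^sub>R j + d *\<^sub>R k"
  unfolding i_def j_def k_def by (simp_all add: quat_eq_iff)

lemma qcnj_mult_self: "x * qcnj x = of_real ((norm x)\<^sup>2)"
proof -
  have "(norm x)\<^sup>2 = (qRe x)\<^sup>2 + (qI x)\<^sup>2 + (qJ x)\<^sup>2 + (qK x)\<^sup>2"
    by (simp add: norm_quat_def)
  then show ?thesis
    by (simp add: quat_eq_iff of_real_def) (simp add: power2_eq_square)
qed


section \<open>Quaternionic matrices\<close>

definition qadjoint :: "quat^'n^'m \<Rightarrow> quat^'m^'n" where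
  "qadjoint A = (\<chi> i j. qcnj (A $ j $ i))"

definition commutator :: "quat^'n^'n \<Rightarrow> quat^'n^'n \<Rightarrow> quat^'n^'n" where
  "commutator X Y = X ** Y - Y ** X"

text \<open>The library norm of a matrix, regarded as a vector of rows, is the Frobenius norm.\<close>

lemma norm_matrix_power2:
  "(norm (A :: quat^'n^'m))\<^sup>2 = (\<Sum>i\<in>UNIV. \<Sum>j\<in>UNIV. (norm (A $ i $ j))\<^sup>2)"
  by (simp add: norm_vec_def L2_set_def sum_nonneg)

text \<open>A column vector is an \<open>n \<times> 1\<close> matrix \<open>u\<close>, so that \<open>u p u\<^sup>*\<close> is
  a product of matrices, the scalar \<open>p\<close> being the \<open>1 \<times> 1\<close> matrix \<^term>\<open>mat p\<close>.\<close>

lemma column_scalar_row: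
  "u ** mat p ** qadjoint u = (\<chi> i j. u $ i $ 1 * p * qcnj (u $ j $ 1))"
  for u :: "quat^1^'n"
  by (simp add: matrix_matrix_mult_def mat_def qadjoint_def vec_eq_iff)

end

theory Submission
  imports Defs
begin

text \<open>The inequality is \<open>\<parallel>XY - YX\<parallel> \<le> \<parallel>XY\<parallel> + \<parallel>YX\<parallel> \<le> 2 \<parallel>X\<parallel> \<parallel>Y\<parallel>\<close>. In the case of equality, both
  products have norm \<open>\<parallel>X\<parallel> \<parallel>Y\<parallel>\<close>, and \<open>XY = - YX\<close> by the parallelogram law. Equality in
  Cauchy--Schwarz for all pairs of a row of \<open>X\<close> and a column of \<open>Y\<close> gives a unit vector \<open>v\<close> with
  \<open>X = z v\<^sup>*\<close> and \<open>Y = v w\<close> for some column \<open>z\<close> and row \<open>w\<close>. Now \<open>XY = - YX\<close> reads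
  \<open>z w = - v (w z) v\<^sup>*\<close>, so that \<open>z\<close> and \<open>w\<^sup>*\<close> are right multiples of \<open>v\<close>. Hence \<open>X = v p v\<^sup>*\<close> and
  \<open>Y = v q v\<^sup>*\<close>, where \<open>p q = - q p\<close>, and nonzero anticommuting quaternions are purely imaginary
  and orthogonal.\<close>

section \<open>Quaternions\<close>

lemma qcnj_qcnj [simp]: "qcnj (qcnj x) = x"
  by (simp add: quat_eq_iff)

lemma qcnj_zero [simp]: "qcnj 0 = 0"
  by (simp add: quat_eq_iff)

lemma qcnj_sum: "qcnj (sum f A) = (\<Sum>x\<in>A. qcnj (f x))"
proof -
  have "qcnj (x + y) = qcnj x + qcnj y" for x y
    by (simp add: quat_eq_iff)
  then show ?thesis
    by (induction A rule: infinite_finite_induct) simp_all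
qed

lemma qcnj_scaleR: "qcnj (r *\<^sub>R x) = r *\<^sub>R qcnj x"
  by (simp add: quat_eq_iff)

lemma norm_qcnj [simp]: "norm (qcnj x) = norm x"
  by (simp add: norm_quat_def)

lemma qcnj_self_mult: "qcnj x * x = of_real ((norm x)\<^sup>2)"
  using qcnj_mult_self [of "qcnj x"] by simp

lemma inner_qcnj_mult: "inner y (qcnj x * z) = inner (x * y) z"
  by (simp add: inner_quat_def algebra_simps)

lemma quat_inverse_exists:
  fixes x :: quat
  assumes "x \<noteq> 0"
  obtains y where "x * y = 1" "y * x = 1"
proof
  show "x * (inverse ((norm x)\<^sup>2) *\<^sub>R qcnj x) = 1" "(inverse ((norm x)\<^sup>2) *\<^sub>R qcnj x) * x = 1"
    using assms by (simp_all add: qcnj_mult_self qcnj_self_mult of_real_def)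
qed

text \<open>Half of \<open>p * q + q * p\<close> has real part \<open>qRe p * qRe q\<close> minus
  the inner product of the imaginary parts, and imaginary part Re p Im q + Re q Im p. The factors
  must be nonzero, since 0 anticommutes with every quaternion.\<close>

lemma purely_imaginary_orthogonal_iff_anticommute:
  fixes p q :: quat
  assumes "p \<noteq> 0" "q \<noteq> 0"
  shows "purely_imaginary p \<and> purely_imaginary q \<and> inner p q = 0 \<longleftrightarrow> p * q + q * p = 0"
proof
  assume "purely_imaginary p \<and> purely_imaginary q \<and> inner p q = 0"
  then show "p * q + q * p = 0"
    by (clarsimp simp: purely_imaginary_def inner_quat_def quat_eq_iff)
next
  have real_part_zero: "qRe p = 0" if "p \<noteq> 0" "q \<noteq> 0" "p * q + q * p = 0" for p q :: quat
  proof (rule ccontr)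
    assume re: "qRe p \<noteq> 0"
    have e: "qRe p * qRe q = qI p * qI q + qJ p * qJ q + qK p * qK q"
      "qRe p * qI q = - (qRe q * qI p)" "qRe p * qJ q = - (qRe q * qJ p)"
      "qRe p * qK q = - (qRe q * qK p)"
      using that(3) by (simp_all add: quat_eq_iff algebra_simps)
    \<comment> \<open>Multiply the first equation of \<open>e\<close> by \<open>qRe p\<close> and
      replace each product of \<open>qRe p\<close> with a coordinate of Im q by the others.\<close>
    have "qRe q * (norm p)\<^sup>2 = 0"
      using e unfolding norm_quat_def by simp algebra
    then have "qRe q = 0"
      using that(1) by simp
    with e re have "q = 0"
      by (simp add: quat_eq_iff)
    with that(2) show False by simp
  qed
  assume pq: "p * q + q * p = 0"
  then have "q * p + p * q = 0"
    by (simp add: add.commute)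
  then have "qRe p = 0" "qRe q = 0"
    using real_part_zero pq assms by blast+
  then show "purely_imaginary p \<and> purely_imaginary q \<and> inner p q = 0"
    using pq by (simp add: purely_imaginary_def inner_quat_def quat_eq_iff)
qed


section \<open>The Cauchy--Schwarz inequality for a row and a column\<close>

lemma norm_power2_vec: "(norm (x :: 'a::real_normed_vector^'n))\<^sup>2 = (\<Sum>i\<in>UNIV. (norm (x $ i))\<^sup>2)"
  by (simp add: norm_vec_def L2_set_def sum_nonneg)

text \<open>Up to the factor \<open>(norm a)\<^sup>2\<close>, the summands on the left are the
  entries of b minus its projection onto the conjugate of a. The right-hand side is thus a multiple
  of the Cauchy--Schwarz defect, which settles the inequality and its equality case
  together.\<close>

lemma row_column_Lagrange:
  fixes a b :: "quat^'n"
  defines "s \<equiv> \<Sum>k\<in>UNIV. a $ k * b $ k"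
  shows "(\<Sum>k\<in>UNIV. (norm ((norm a)\<^sup>2 *\<^sub>R b $ k - qcnj (a $ k) * s))\<^sup>2) =
    (norm a)\<^sup>2 * ((norm a)\<^sup>2 * (norm b)\<^sup>2 - (norm s)\<^sup>2)"
proof -
  define r where "r = (norm a)\<^sup>2"
  have norm_diff: "(norm (x - y))\<^sup>2 = (norm x)\<^sup>2 - 2 * inner x y + (norm y)\<^sup>2" for x y :: quat
    by (simp add: power2_norm_eq_inner inner_diff_left inner_diff_right inner_commute)
  \<comment> \<open>Moving \<open>qcnj (a $ k)\<close> to the other side of the inner product makes
    the cross terms add up to the inner product of s with itself.\<close>
  have term_eq: "(norm (r *\<^sub>R b $ k - qcnj (a $ k) * s))\<^sup>2 =
      r\<^sup>2 * (norm (b $ k))\<^sup>2 - 2 * r * inner (a $ k * b $ k) s + (norm (a $ k))\<^sup>2 * (norm s)\<^sup>2" for k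
    by (simp add: norm_diff inner_qcnj_mult norm_quat_mult power_mult_distrib)
  have "(\<Sum>k\<in>UNIV. inner (a $ k * b $ k) s) = (norm s)\<^sup>2"
    by (simp add: s_def inner_sum_left [symmetric] dot_square_norm)
  then show ?thesis
    unfolding r_def [symmetric] term_eq
    by (simp add: sum.distrib sum_subtractf sum_distrib_left [symmetric]
        sum_distrib_right [symmetric] norm_power2_vec [symmetric])
      (simp add: r_def algebra_simps power2_eq_square)
qed

lemma row_column_Cauchy_Schwarz:
  fixes a b :: "quat^'n"
  shows "(norm (\<Sum>k\<in>UNIV. a $ k * b $ k))\<^sup>2 \<le> (norm a)\<^sup>2 * (norm b)\<^sup>2"
proof (cases "a = 0")
  case False
  have "0 \<le> (norm a)\<^sup>2 * ((norm a)\<^sup>2 * (norm b)\<^sup>2 - (norm (\<Sum>k\<in>UNIV. a $ k * b $ k))\<^sup>2)"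
    unfolding row_column_Lagrange [symmetric] by (simp add: sum_nonneg)
  with False show ?thesis
    by (simp add: zero_le_mult_iff)
qed simp

lemma row_column_Cauchy_Schwarz_eqD:
  fixes a b :: "quat^'n"
  assumes "(norm (\<Sum>k\<in>UNIV. a $ k * b $ k))\<^sup>2 = (norm a)\<^sup>2 * (norm b)\<^sup>2"
  shows "(norm a)\<^sup>2 *\<^sub>R b $ k = qcnj (a $ k) * (\<Sum>k\<in>UNIV. a $ k * b $ k)"
    and "(norm b)\<^sup>2 *\<^sub>R a $ k = (\<Sum>k\<in>UNIV. a $ k * b $ k) * qcnj (b $ k)"
proof -
  have *: "(norm a)\<^sup>2 *\<^sub>R b $ k = qcnj (a $ k) * (\<Sum>k\<in>UNIV. a $ k * b $ k)"
    if "(norm (\<Sum>k\<in>UNIV. a $ k * b $ k))\<^sup>2 = (norm a)\<^sup>2 * (norm b)\<^sup>2" for a b :: "quat^'n" and k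
    using row_column_Lagrange [of a b] that by (simp add: sum_nonneg_eq_0_iff)
  from * [OF assms] show "(norm a)\<^sup>2 *\<^sub>R b $ k = qcnj (a $ k) * (\<Sum>k\<in>UNIV. a $ k * b $ k)" .
  \<comment> \<open>Conjugation reverses products, so the second identity is the first one for the
    conjugated pair in the opposite order.\<close>
  define a' b' :: "quat^'n" where "a' = (\<chi> k. qcnj (a $ k))" and "b' = (\<chi> k. qcnj (b $ k))"
  have norms: "(norm a')\<^sup>2 = (norm a)\<^sup>2" "(norm b')\<^sup>2 = (norm b)\<^sup>2"
    by (simp_all add: a'_def b'_def norm_power2_vec)
  have s: "(\<Sum>k\<in>UNIV. b' $ k * a' $ k) = qcnj (\<Sum>k\<in>UNIV. a $ k * b $ k)"
    by (simp add: a'_def b'_def qcnj_sum qcnj_mult)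
  have "(norm b)\<^sup>2 *\<^sub>R a' $ k = qcnj (b' $ k) * qcnj (\<Sum>k\<in>UNIV. a $ k * b $ k)"
    using * [of b' a' k] assms by (simp add: norms s mult.commute)
  then have "qcnj ((norm b)\<^sup>2 *\<^sub>R a' $ k) = qcnj (qcnj (b' $ k) * qcnj (\<Sum>k\<in>UNIV. a $ k * b $ k))"
    by simp
  then show "(norm b)\<^sup>2 *\<^sub>R a $ k = (\<Sum>k\<in>UNIV. a $ k * b $ k) * qcnj (b $ k)"
    by (simp add: a'_def b'_def qcnj_scaleR qcnj_mult)
qed


section \<open>The Frobenius norm of a product\<close>

lemma norm_power2_rows: "(norm (A :: quat^'n^'m))\<^sup>2 = (\<Sum>i\<in>UNIV. (norm (row i A))\<^sup>2)"
  by (simp add: row_def norm_power2_vec)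

lemma norm_power2_columns: "(norm (A :: quat^'n^'m))\<^sup>2 = (\<Sum>j\<in>UNIV. (norm (column j A))\<^sup>2)"
  by (simp add: column_def norm_power2_vec) (rule sum.swap)

lemma matrix_mult_row_column: "(A ** B) $ i $ j = (\<Sum>k\<in>UNIV. row i A $ k * column j B $ k)"
  by (simp add: matrix_matrix_mult_def row_def column_def)

text \<open>Cauchy--Schwarz bounds each entry of the product, and these bounds sum to the square of
  \<open>norm A * norm B\<close>. Equality of the sums therefore forces equality in every
  entry.\<close>

lemma
  fixes A :: "quat^'n^'m" and B :: "quat^'l^'n"
  shows norm_matrix_mult_le: "norm (A ** B) \<le> norm A * norm B"
    and norm_matrix_mult_eqD: "norm (A ** B) = norm A * norm B \<Longrightarrow>
      (norm ((A ** B) $ i $ j))\<^sup>2 = (norm (row i A))\<^sup>2 * (norm (column j B))\<^sup>2"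
proof -
  define f where "f = (\<lambda>(i, j). (norm ((A ** B) $ i $ j))\<^sup>2)"
  define g where "g = (\<lambda>(i, j). (norm (row i A))\<^sup>2 * (norm (column j B))\<^sup>2)"
  have fg: "f x \<le> g x" for x
    by (cases x) (simp add: f_def g_def matrix_mult_row_column row_column_Cauchy_Schwarz)
  have f: "(norm (A ** B))\<^sup>2 = sum f UNIV"
    by (simp add: f_def norm_matrix_power2 sum.cartesian_product)
  have g: "(norm A * norm B)\<^sup>2 = sum g UNIV"
    by (simp add: g_def power_mult_distrib norm_power2_rows [of A] norm_power2_columns [of B]
        sum_product sum.cartesian_product)
  have "(norm (A ** B))\<^sup>2 \<le> (norm A * norm B)\<^sup>2"
    unfolding f g by (intro sum_mono fg)
  then show "norm (A ** B) \<le> norm A * norm B"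
    by (rule power2_le_imp_le) simp
  assume "norm (A ** B) = norm A * norm B"
  then have "(\<Sum>x\<in>UNIV. g x - f x) = 0"
    using f g by (simp add: sum_subtractf)
  then have "g (i, j) - f (i, j) = 0"
    using fg by (subst (asm) sum_nonneg_eq_0_iff) (auto simp: algebra_simps)
  then show "(norm ((A ** B) $ i $ j))\<^sup>2 = (norm (row i A))\<^sup>2 * (norm (column j B))\<^sup>2"
    by (simp add: f_def g_def)
qed

text \<open>Entrywise equality makes every column of B a right multiple of the conjugate of one
  nonzero row of A, and every row of A a left multiple of the conjugate of one nonzero column of
  B.\<close>

lemma norm_matrix_mult_eqE:
  fixes A :: "quat^'n^'m" and B :: "quat^'l^'n"
  assumes eq: "norm (A ** B) = norm A * norm B" and "A \<noteq> 0" "B \<noteq> 0"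
  obtains v :: "quat^'n" and z :: "quat^'m" and w :: "quat^'l"
  where "norm v = 1" "A = (\<chi> i k. z $ i * qcnj (v $ k))" "B = (\<chi> k j. v $ k * w $ j)"
proof -
  obtain i0 where i0: "row i0 A \<noteq> 0"
    using \<open>A \<noteq> 0\<close> by (auto simp: row_def vec_eq_iff)
  obtain j0 where j0: "column j0 B \<noteq> 0"
    using \<open>B \<noteq> 0\<close> by (auto simp: column_def vec_eq_iff)
  define a where "a = norm (row i0 A)"
  define b where "b = (norm (column j0 B))\<^sup>2"
  have pos: "a > 0" "b > 0"
    using i0 j0 by (simp_all add: a_def b_def)
  \<comment> \<open>The vector v is the normalised conjugate of row i0; w and z collect the factors
    that the two equality identities then leave.\<close>
  define v :: "quat^'n" where "v = (\<chi> k. inverse a *\<^sub>R qcnj (A $ i0 $ k))"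
  define w :: "quat^'l" where "w = (\<chi> j. inverse a *\<^sub>R (A ** B) $ i0 $ j)"
  define z :: "quat^'m" where "z = (\<chi> i. inverse b *\<^sub>R ((A ** B) $ i $ j0 * qcnj (w $ j0)))"
  have B: "B $ k $ j = v $ k * w $ j" for k j
  proof -
    have "a\<^sup>2 *\<^sub>R B $ k $ j = qcnj (A $ i0 $ k) * (A ** B) $ i0 $ j"
      unfolding a_def
      using row_column_Cauchy_Schwarz_eqD(1) [of "row i0 A" "column j B" k]
        norm_matrix_mult_eqD [OF eq, of i0 j]
      by (simp add: matrix_mult_row_column) (simp add: row_def column_def)
    then have "inverse (a\<^sup>2) *\<^sub>R (a\<^sup>2 *\<^sub>R B $ k $ j) = v $ k * w $ j"
      by (simp add: v_def w_def power2_eq_square)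
    then show ?thesis
      using pos by simp
  qed
  have A: "A $ i $ k = z $ i * qcnj (v $ k)" for i k
  proof -
    have "b *\<^sub>R A $ i $ k = (A ** B) $ i $ j0 * qcnj (B $ k $ j0)"
      unfolding b_def
      using row_column_Cauchy_Schwarz_eqD(2) [of "row i A" "column j0 B" k]
        norm_matrix_mult_eqD [OF eq, of i j0]
      by (simp add: matrix_mult_row_column) (simp add: row_def column_def)
    then have "inverse b *\<^sub>R (b *\<^sub>R A $ i $ k) = z $ i * qcnj (v $ k)"
      by (simp add: z_def B qcnj_mult mult.assoc)
    then show ?thesis
      using pos by simp
  qed
  have "(norm v)\<^sup>2 = (inverse a)\<^sup>2 * (norm (row i0 A))\<^sup>2"
    using pos by (simp add: norm_power2_vec v_def row_def power_mult_distrib sum_distrib_left)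
  also have "\<dots> = 1"
    using pos by (simp add: a_def field_simps)
  finally have "norm v = 1"
    by (simp add: abs_square_eq_1)
  with A B show thesis
    by (intro that [of v z w]) (simp_all add: vec_eq_iff)
qed


section \<open>Matrices of the form \<open>v p v\<^sup>*\<close>\<close>

definition rank_one :: "quat^'n \<Rightarrow> quat \<Rightarrow> quat^'n^'n" where
  "rank_one v p = (\<chi> i j. v $ i * p * qcnj (v $ j))"

lemma sum_qcnj_mult_self: "(\<Sum>k\<in>UNIV. qcnj (v $ k) * v $ k) = of_real ((norm v)\<^sup>2)"
  by (simp add: norm_power2_vec qcnj_self_mult)

lemma norm_rank_one: "norm (rank_one v p) = (norm v)\<^sup>2 * norm p"
proof -
  have "(norm (rank_one v p))\<^sup>2 = ((norm v)\<^sup>2 * norm p)\<^sup>2"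
    unfolding rank_one_def norm_matrix_power2
    by (simp add: norm_quat_mult power_mult_distrib sum_distrib_left [symmetric]
        sum_distrib_right [symmetric] norm_power2_vec [symmetric])
  then show ?thesis
    by (rule power2_eq_imp_eq) simp_all
qed

text \<open>The inner factor \<open>v\<^sup>* v\<close> equals 1.\<close>

lemma rank_one_mult:
  assumes "norm v = 1"
  shows "rank_one v p ** rank_one v q = rank_one v (p * q)"
proof -
  have "(\<Sum>k\<in>UNIV. v $ i * p * qcnj (v $ k) * (v $ k * q * qcnj (v $ j))) =
      v $ i * p * (\<Sum>k\<in>UNIV. qcnj (v $ k) * v $ k) * (q * qcnj (v $ j))" for i j
    by (simp add: sum_distrib_left sum_distrib_right mult.assoc)
  then show ?thesis
    using assms by (simp add: rank_one_def matrix_matrix_mult_def vec_eq_iff sum_qcnj_mult_self mult.assoc)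
qed

lemma rank_one_add: "rank_one v p + rank_one v q = rank_one v (p + q)"
  by (simp add: rank_one_def vec_eq_iff algebra_simps)

lemma rank_one_diff: "rank_one v p - rank_one v q = rank_one v (p - q)"
  by (simp add: rank_one_def vec_eq_iff algebra_simps)

text \<open>Passes from the one-column matrices of the theorem to plain vectors, with the condition
  on the scalars kept as a parameter.\<close>

lemma ex_column_iff_ex_rank_one:
  "(\<exists>(u :: quat^1^'n) p q. norm u = 1 \<and> P p q \<and>
      X = u ** mat p ** qadjoint u \<and> Y = u ** mat q ** qadjoint u) \<longleftrightarrow>
    (\<exists>v p q. norm v = 1 \<and> P p q \<and> X = rank_one v p \<and> Y = rank_one v q)"
  (is "?L \<longleftrightarrow> ?R")
proof
  assume ?L
  then obtain u :: "quat^1^'n" and p q where u: "norm u = 1" "P p q"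
    "X = u ** mat p ** qadjoint u" "Y = u ** mat q ** qadjoint u"
    by blast
  moreover have "norm (column 1 u) = norm u"
    by (simp add: column_def norm_vec_def L2_set_def)
  ultimately show ?R
    by (intro exI [of _ "column 1 u"] exI [of _ p] exI [of _ q])
      (simp add: column_scalar_row rank_one_def column_def)
next
  assume ?R
  then obtain v p q where v: "norm v = 1" "P p q" "X = rank_one v p" "Y = rank_one v q"
    by blast
  define u :: "quat^1^'n" where "u = (\<chi> i j. v $ i)"
  have "norm u = norm v"
    by (simp add: u_def norm_vec_def L2_set_def)
  with v show ?L
    by (intro exI [of _ u] exI [of _ p] exI [of _ q])
      (simp add: column_scalar_row rank_one_def u_def)
qed


section \<open>Commutators\<close>

lemma norm_commutator_le: "norm (commutator X Y) \<le> 2 * norm X * norm Y"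
proof -
  have "norm (commutator X Y) \<le> norm (X ** Y) + norm (Y ** X)"
    unfolding commutator_def by (rule norm_triangle_ineq4)
  with norm_matrix_mult_le [of X Y] norm_matrix_mult_le [of Y X] show ?thesis
    by (simp add: mult.commute [of "norm Y"])
qed

lemma norm_commutator_eqD:
  assumes "norm (commutator X Y) = 2 * norm X * norm Y"
  shows "norm (X ** Y) = norm X * norm Y" and "X ** Y + Y ** X = 0"
proof -
  have tri: "norm (commutator X Y) \<le> norm (X ** Y) + norm (Y ** X)"
    unfolding commutator_def by (rule norm_triangle_ineq4)
  have le: "norm (X ** Y) \<le> norm X * norm Y" "norm (Y ** X) \<le> norm X * norm Y"
    using norm_matrix_mult_le [of X Y] norm_matrix_mult_le [of Y X]
    by (simp_all add: mult.commute)
  show XY: "norm (X ** Y) = norm X * norm Y"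
    using assms tri le by linarith
  have YX: "norm (Y ** X) = norm X * norm Y"
    using assms tri le by linarith
  \<comment> \<open>Parallelogram law: the commutator already accounts for the whole right-hand
    side, leaving nothing for the sum.\<close>
  have "(norm (X ** Y + Y ** X))\<^sup>2 + (norm (X ** Y - Y ** X))\<^sup>2 =
      2 * (norm (X ** Y))\<^sup>2 + 2 * (norm (Y ** X))\<^sup>2"
    by (simp add: power2_norm_eq_inner inner_add_left inner_add_right inner_diff_left
        inner_diff_right)
  then have "(norm (X ** Y + Y ** X))\<^sup>2 = 0"
    using assms by (simp add: XY YX commutator_def power_mult_distrib)
  then show "X ** Y + Y ** X = 0"
    by simp
qed

lemma norm_commutator_eqE:
  fixes X Y :: "quat^'n^'n"
  assumes eq: "norm (commutator X Y) = 2 * norm X * norm Y" and nz: "X \<noteq> 0" "Y \<noteq> 0"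
  obtains v p q where "norm v = 1" "X = rank_one v p" "Y = rank_one v q"
proof -
  obtain v z w :: "quat^'n" where v: "norm v = 1"
    and X: "X = (\<chi> i k. z $ i * qcnj (v $ k))" and Y: "Y = (\<chi> k j. v $ k * w $ j)"
    using norm_matrix_mult_eqE [OF norm_commutator_eqD(1) [OF eq] nz] .
  define c where "c = (\<Sum>k\<in>UNIV. w $ k * z $ k)"
  have zw: "z $ i * w $ j = - (v $ i * c * qcnj (v $ j))" for i j
  proof -
    have "(X ** Y) $ i $ j = z $ i * (\<Sum>k\<in>UNIV. qcnj (v $ k) * v $ k) * w $ j"
      by (simp add: X Y matrix_matrix_mult_def sum_distrib_left sum_distrib_right mult.assoc)
    moreover have "(Y ** X) $ i $ j = v $ i * c * qcnj (v $ j)"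
      by (simp add: X Y c_def matrix_matrix_mult_def sum_distrib_left sum_distrib_right mult.assoc)
    moreover have "(X ** Y) $ i $ j + (Y ** X) $ i $ j = 0"
      using norm_commutator_eqD(2) [OF eq] by (simp add: vec_eq_iff)
    ultimately show ?thesis
      using v by (simp add: sum_qcnj_mult_self eq_neg_iff_add_eq_0)
  qed
  \<comment> \<open>Cancelling a nonzero entry of w on the right in \<open>zw\<close> expresses z
    through v; cancelling a nonzero entry of z on the left expresses w through the conjugate of
    v.\<close>
  have "z \<noteq> 0"
    using \<open>X \<noteq> 0\<close> by (intro notI) (simp add: X vec_eq_iff)
  then obtain i where "z $ i \<noteq> 0"
    by (auto simp: vec_eq_iff)
  then obtain z' where z': "z' * z $ i = 1"
    by (blast elim: quat_inverse_exists)
  have "w \<noteq> 0"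
    using \<open>Y \<noteq> 0\<close> by (intro notI) (simp add: Y vec_eq_iff)
  then obtain j where "w $ j \<noteq> 0"
    by (auto simp: vec_eq_iff)
  then obtain w' where w': "w $ j * w' = 1"
    by (blast elim: quat_inverse_exists)
  have "z $ k = v $ k * - (c * qcnj (v $ j) * w')" for k
    using arg_cong [OF zw [of k j], of "\<lambda>x. x * w'"] by (simp add: mult.assoc w')
  moreover have "w $ k = - (z' * v $ i * c) * qcnj (v $ k)" for k
    using arg_cong [OF zw [of i k], of "\<lambda>x. z' * x"] by (simp add: mult.assoc [symmetric] z')
  ultimately have "X = rank_one v (- (c * qcnj (v $ j) * w'))" "Y = rank_one v (- (z' * v $ i * c))"
    by (simp_all add: X Y rank_one_def vec_eq_iff mult.assoc)
  with v show thesis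
    by (rule that)
qed

text \<open>For unit v, \<open>rank_one v\<close> preserves sums, products and norms, so the
  question reduces to when p and q anticommute.\<close>

lemma norm_commutator_eq_iff:
  fixes X Y :: "quat^'n^'n"
  assumes "X \<noteq> 0" "Y \<noteq> 0"
  shows "norm (commutator X Y) = 2 * norm X * norm Y \<longleftrightarrow>
    (\<exists>v p q. norm v = 1 \<and> (purely_imaginary p \<and> purely_imaginary q \<and> inner p q = 0) \<and>
      X = rank_one v p \<and> Y = rank_one v q)"
    (is "?L \<longleftrightarrow> ?R")
proof
  assume eq: ?L
  obtain v p q where v: "norm v = 1" "X = rank_one v p" "Y = rank_one v q"
    using norm_commutator_eqE [OF eq assms] .
  have "p \<noteq> 0" "q \<noteq> 0"
    using assms norm_rank_one [of v 0] by (auto simp: v)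
  moreover have "rank_one v (p * q + q * p) = 0"
    using norm_commutator_eqD(2) [OF eq] v by (simp add: rank_one_mult rank_one_add)
  then have "p * q + q * p = 0"
    using norm_rank_one [of v "p * q + q * p"] v(1) by simp
  ultimately show ?R
    using v purely_imaginary_orthogonal_iff_anticommute by blast
next
  assume ?R
  then obtain v p q where v: "norm v = 1" "X = rank_one v p" "Y = rank_one v q"
    and pq: "purely_imaginary p \<and> purely_imaginary q \<and> inner p q = 0"
    by blast
  have "p \<noteq> 0" "q \<noteq> 0"
    using assms norm_rank_one [of v 0] by (auto simp: v)
  then have "q * p = - (p * q)"
    using pq purely_imaginary_orthogonal_iff_anticommute [of p q]
    by (simp add: eq_neg_iff_add_eq_0 add.commute)
  \<comment> \<open>Anticommutation doubles the product instead of cancelling it, and the quaternion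
    norm is multiplicative.\<close>
  then have "commutator X Y = rank_one v (2 *\<^sub>R (p * q))"
    by (simp add: commutator_def v rank_one_mult rank_one_diff scaleR_2)
  then show ?L
    by (simp add: v norm_rank_one norm_quat_mult)
qed

theorem theorem3p5:
  fixes X Y :: "quat^'n^'n"
  shows "(norm (commutator X Y))\<^sup>2 \<le> 4 * (norm X)\<^sup>2 * (norm Y)\<^sup>2 \<and>
    ((norm (commutator X Y))\<^sup>2 = 4 * (norm X)\<^sup>2 * (norm Y)\<^sup>2 \<longleftrightarrow>
      norm X * norm Y = 0 \<or>
      (\<exists>(u :: quat^1^'n) p q.
         norm u = 1 \<and> purely_imaginary p \<and> purely_imaginary q \<and> inner p q = 0 \<and>
         X = u ** mat p ** qadjoint u \<and> Y = u ** mat q ** qadjoint u))"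
proof -
  have sq: "4 * (norm X)\<^sup>2 * (norm Y)\<^sup>2 = (2 * norm X * norm Y)\<^sup>2"
    by (simp add: power_mult_distrib)
  have "(norm (commutator X Y))\<^sup>2 \<le> (2 * norm X * norm Y)\<^sup>2"
    by (intro power_mono norm_commutator_le) simp
  moreover have "(norm (commutator X Y))\<^sup>2 = (2 * norm X * norm Y)\<^sup>2 \<longleftrightarrow>
      norm (commutator X Y) = 2 * norm X * norm Y"
    by (intro power2_eq_iff_nonneg) simp_all
  \<comment> \<open>In the degenerate case the upper bound is 0, so equality is automatic.\<close>
  moreover have "norm (commutator X Y) = 2 * norm X * norm Y" if "norm X * norm Y = 0"
    using norm_commutator_le [of X Y] that by (simp add: mult.assoc)
  ultimately show ?thesis
    using norm_commutator_eq_iff [of X Y]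
      ex_column_iff_ex_rank_one
        [where P = "\<lambda>p q. purely_imaginary p \<and> purely_imaginary q \<and> inner p q = 0" and X = X and Y = Y]
    unfolding sq by (auto simp: conj_assoc)
qed

end
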